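(* Let $n,k,m\in\mathbb N$, let $R=[r_1\dots r_k]^T$ and $\Lambda=[\lambda_1\dots\lambda_m]^T$ with all $r_i,\lambda_i\in\mathbb N$, and let $H=[h_1\dots h_m]^T$ with $h_1,\dots,h_m\in\{1,\dots,n\}$ distinct. Then $\Lambda K_n^H$ is $R$-factorizable if and only if $\sum_{i=1}^k r_i=\sum_{i=1}^m\lambda_i\binom{n-1}{h_i-1}$ and there exists a non-negative integer matrix $A=[a_{ij}]_{k\times m}$ such that $AH=nR$ and $\sum_{i=1}^k a_{ij}=\lambda_j\binom{n}{h_j}$ for $1\le j\le m$.
   Context: $\Lambda K_n^H$ is the hypergraph on a vertex set of $n$ vertices in which, for each $1\le i\le m$ and each set of $h_i$ distinct vertices, there are exactly $\lambda_i$ edges of size $h_i$ joining exactly those $h_i$ vertices (each such edge attached to each of its vertices by exactly one hinge). The degree of a vertex is the number of edge incidences at it. An $r$-factor is an $r$-regular spanning sub-hypergraph. An $R$-factorization is a partition $\{F_1,\dots,F_k\}$ of the edge set such that $F_i$ (with all vertices) is an $r_i$-factor for $1\le i\le k$. *)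

theory Defs
  imports "HOL-Library.Multiset" "HOL-Library.Disjoint_Sets" "Jordan_Normal_Form.Matrix"
begin

text \<open>An edge is attached to a vertex by finitely many hinges. Edges are named, so that parallel
  edges are possible, and the hinges of an edge \<open>e\<close> are recorded by the multiset \<open>ends G e\<close>:
  the multiplicity of \<open>v\<close> is the number of hinges between \<open>e\<close> and \<open>v\<close>.\<close>

record ('v, 'e) hypergraph =
  verts :: "'v set"
  edges :: "'e set"
  ends :: "'e \<Rightarrow> 'v multiset"

definition hdegree :: "('v, 'e) hypergraph \<Rightarrow> 'v \<Rightarrow> nat" where
  "hdegree G v = (\<Sum>e\<in>edges G. count (ends G e) v)"

definition regular_hypergraph :: "nat \<Rightarrow> ('v, 'e) hypergraph \<Rightarrow> bool" where
  "regular_hypergraph r G \<longleftrightarrow> (\<forall>v\<in>verts G. hdegree G v = r)"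

definition spanning_sub_hypergraph ::
    "('v, 'e) hypergraph \<Rightarrow> ('v, 'e) hypergraph \<Rightarrow> bool" where
  "spanning_sub_hypergraph F G \<longleftrightarrow>
     verts F = verts G \<and> edges F \<subseteq> edges G \<and> (\<forall>e\<in>edges F. ends F e = ends G e)"

definition is_factor :: "nat \<Rightarrow> ('v, 'e) hypergraph \<Rightarrow> ('v, 'e) hypergraph \<Rightarrow> bool" where
  "is_factor r G F \<longleftrightarrow> spanning_sub_hypergraph F G \<and> regular_hypergraph r F"

text \<open>The classes are indexed, \<open>F i\<close> being the edge set of the \<open>R $ i\<close>-factor. On a nonempty vertex
  set a class can be empty only if \<open>R $ i = 0\<close>.\<close>

definition is_factorization :: "nat vec \<Rightarrow> ('v, 'e) hypergraph \<Rightarrow> (nat \<Rightarrow> 'e set) \<Rightarrow> bool" where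
  "is_factorization R G F \<longleftrightarrow>
     (\<Union>i<dim_vec R. F i) = edges G \<and>
     disjoint_family_on F {..<dim_vec R} \<and>
     (\<forall>i<dim_vec R. is_factor (R $ i) G (G\<lparr>edges := F i\<rparr>))"

definition factorizable :: "nat vec \<Rightarrow> ('v, 'e) hypergraph \<Rightarrow> bool" where
  "factorizable R G \<longleftrightarrow> (\<exists>F. is_factorization R G F)"

text \<open>\<open>is_complete_hypergraph n L H G\<close> says that \<open>G\<close> is (a copy of) $\Lambda K_n^H$, with \<open>L\<close> for
  $\Lambda$. Each edge is attached to the vertices of some set \<open>S\<close> by exactly one hinge each, which
  is what \<open>mset_set S\<close> expresses.\<close>

definition is_complete_hypergraph ::
    "nat \<Rightarrow> nat vec \<Rightarrow> nat vec \<Rightarrow> ('v, 'e) hypergraph \<Rightarrow> bool" where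
  "is_complete_hypergraph n L H G \<longleftrightarrow>
     finite (verts G) \<and> card (verts G) = n \<and> finite (edges G) \<and>
     (\<forall>e\<in>edges G. \<exists>j<dim_vec H. \<exists>S\<subseteq>verts G. card S = H $ j \<and> ends G e = mset_set S) \<and>
     (\<forall>j<dim_vec H. \<forall>S\<subseteq>verts G. card S = H $ j \<longrightarrow>
        card {e \<in> edges G. ends G e = mset_set S} = L $ j)"

text \<open>Such a hypergraph exists for all parameters with distinct sizes.\<close>

lemma ex_complete_hypergraph:
  assumes "inj_on (($) H) {..<dim_vec H}"
  shows "\<exists>G :: (nat, nat \<times> nat set \<times> nat) hypergraph. is_complete_hypergraph n L H G"
proof -
  define E where "E = {(j, S, t). j < dim_vec H \<and> S \<subseteq> {..<n} \<and> card S = H $ j \<and> t < L $ j}"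
  define G where "G = \<lparr>verts = {..<n}, edges = E, ends = (\<lambda>(j, S, t). mset_set S)\<rparr>"
  have "E \<subseteq> Sigma {..<dim_vec H} (\<lambda>j. Pow {..<n} \<times> {..<L $ j})"
    unfolding E_def by auto
  then have "finite E" by (rule finite_subset) auto
  moreover have "card {e \<in> E. (case e of (j, S, t) \<Rightarrow> mset_set S) = mset_set S} = L $ j"
    if "j < dim_vec H" "S \<subseteq> {..<n}" "card S = H $ j" for j S
  proof -
    have *: "T = S" if "T \<subseteq> {..<n}" "mset_set T = mset_set S" for T
      using that \<open>S \<subseteq> {..<n}\<close> by (metis finite_lessThan finite_set_mset_mset_set finite_subset)
    have "{e \<in> E. (case e of (j, S, t) \<Rightarrow> mset_set S) = mset_set S} = (\<lambda>t. (j, S, t)) ` {..<L $ j}"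
    proof (intro equalityI subsetI)
      fix e assume "e \<in> {e \<in> E. (case e of (j, S, t) \<Rightarrow> mset_set S) = mset_set S}"
      then obtain i T t where e: "e = (i, T, t)" "i < dim_vec H" "T \<subseteq> {..<n}" "card T = H $ i"
        "t < L $ i" "mset_set T = mset_set S" unfolding E_def by auto
      have T: "T = S" using *[OF e(3,6)] .
      then have "H $ i = H $ j" using e(4) that(3) by simp
      then have "i = j" using assms e(2) that(1) by (auto dest: inj_onD)
      then show "e \<in> (\<lambda>t. (j, S, t)) ` {..<L $ j}" using e T by auto
    qed (use that in \<open>auto simp: E_def\<close>)
    also have "card \<dots> = L $ j" by (subst card_image) (auto simp: inj_on_def)
    finally show ?thesis .
  qed
  ultimately have "is_complete_hypergraph n L H G"
    unfolding is_complete_hypergraph_def G_def by (auto simp: E_def)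
  then show ?thesis by blast
qed

end

theory Submission
  imports Defs "HOL-Library.Transitive_Closure_Table"
begin

text \<open>Necessity is double counting. For sufficiency, as in Baranyai's theorem, start with \<open>A $$ (i, j)\<close>
  edges of colour \<open>i\<close> and size \<open>H $ j\<close> all of whose hinges sit at one amalgamated vertex, and detach
  the \<open>n\<close> vertices one at a time. When \<open>N\<close> vertices are still amalgamated, giving the next vertex
  exactly the fraction \<open>1 / N\<close> of the hinges in each class of like edges would keep all colour
  degrees and all edge multiplicities right; these totals are integers, so by the integrality of
  transportation problems the fractions can be replaced by integers.\<close>

section \<open>Integral transportation\<close>

text \<open>Pushing a unit changes the residual relation, so it can be compared before and after
  only on the vertices of the path.\<close>

lemma rtrancl_path_mono_on:
  assumes "rtrancl_path r x xs y"
    and "\<And>u v. u \<in> set (x # xs) \<Longrightarrow> v \<in> set xs \<Longrightarrow> r u v \<Longrightarrow> s u v"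
  shows "rtrancl_path s x xs y"
  using assms
proof induction
  case (base x)
  show ?case by (rule rtrancl_path.base)
next
  case (step x y ys z)
  have "rtrancl_path s y ys z" by (rule step.IH) (use step.prems in auto)
  moreover have "s x y" using step by simp
  ultimately show ?case by (rule rtrancl_path.step[rotated])
qed

text \<open>The residual graph of the transportation network with the rows contracted: along an arc,
  some row can move one unit from column \<open>b\<close> to column \<open>b'\<close> within the
  bounds \<open>0\<close> and \<open>u\<close>.\<close>

definition residual :: "'a set \<Rightarrow> 'b set \<Rightarrow> ('a \<Rightarrow> 'b \<Rightarrow> nat) \<Rightarrow> ('a \<Rightarrow> 'b \<Rightarrow> nat) \<Rightarrow> 'b \<Rightarrow> 'b \<Rightarrow> bool" where
  "residual A B u y b b' \<longleftrightarrow> b \<in> B \<and> b' \<in> B \<and> (\<exists>i\<in>A. 0 < y i b \<and> y i b' < u i b')"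

text \<open>Column sums are left free: augmentation repairs them while row sums and bounds stay in
  force.\<close>

definition rows_capped :: "'a set \<Rightarrow> 'b set \<Rightarrow> ('a \<Rightarrow> 'b \<Rightarrow> nat) \<Rightarrow> ('a \<Rightarrow> nat) \<Rightarrow> ('a \<Rightarrow> 'b \<Rightarrow> nat) \<Rightarrow> bool" where
  "rows_capped A B u r y \<longleftrightarrow> (\<forall>i\<in>A. (\<Sum>b\<in>B. y i b) = r i \<and> (\<forall>b\<in>B. y i b \<le> u i b))"

text \<open>One unit moves from \<open>x\<close> to \<open>z\<close>; indicators are added on both
  sides so that no truncated subtraction occurs.\<close>

lemma sum_plus_of_bool:
  fixes f g :: "'b \<Rightarrow> nat"
  assumes "finite B" "x \<in> B" "z \<in> B" "\<And>b. b \<in> B \<Longrightarrow> f b + of_bool (b = x) = g b + of_bool (b = z)"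
  shows "sum f B = sum g B"
proof -
  have "sum f B + (\<Sum>b\<in>B. of_bool (b = x)) = sum g B + (\<Sum>b\<in>B. of_bool (b = z))"
    unfolding sum.distrib[symmetric] by (rule sum.cong) (use assms in auto)
  moreover have "(\<Sum>b\<in>B. of_bool (b = w)) = (1::nat)" if "w \<in> B" for w
    using assms(1) that by (simp add: of_bool_def)
  ultimately show ?thesis using assms by simp
qed

text \<open>Pushing the first step of a path without repeated columns leaves the rest of it residual.\<close>

lemma augment_along_path:
  assumes "finite A" "finite B"
    and "rtrancl_path (residual A B u y) b p b'" "distinct (b # p)" "b \<in> B"
    and "rows_capped A B u r y"
  shows "\<exists>y'. rows_capped A B u r y' \<and>
    (\<forall>c\<in>B. (\<Sum>i\<in>A. y' i c) + of_bool (c = b) = (\<Sum>i\<in>A. y i c) + of_bool (c = b'))"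
  using assms(3-)
proof (induction p arbitrary: b y)
  case Nil
  then have "b' = b" by (auto elim: rtrancl_path.cases)
  then show ?case using Nil by blast
next
  case (Cons b1 p)
  from Cons.prems(1) have e: "residual A B u y b b1" and q: "rtrancl_path (residual A B u y) b1 p b'"
    by (auto elim: rtrancl_path.cases)
  from e obtain i where i: "i \<in> A" "0 < y i b" "y i b1 < u i b1" and b1: "b1 \<in> B"
    unfolding residual_def by blast
  have ne: "b \<noteq> b1" using Cons.prems(2) by simp
  define z where "z = y(i := (y i)(b := y i b - 1, b1 := y i b1 + 1))"
  have z: "z j c + of_bool (j = i \<and> c = b) = y j c + of_bool (j = i \<and> c = b1)" for j c
    using ne i by (auto simp: z_def)
  have "rows_capped A B u r z" unfolding rows_capped_def
  proof (intro ballI conjI)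
    fix j assume j: "j \<in> A"
    have "(\<Sum>c\<in>B. z j c) = (\<Sum>c\<in>B. y j c)"
    proof (cases "j = i")
      case True
      show ?thesis
        by (rule sum_plus_of_bool[OF assms(2) Cons.prems(3) b1]) (use z[of j] True in auto)
    next
      case False
      then show ?thesis by (simp add: z_def)
    qed
    also have "\<dots> = r j" using Cons.prems(4) j by (simp add: rows_capped_def)
    finally show "(\<Sum>c\<in>B. z j c) = r j" .
    fix c assume "c \<in> B"
    then have "y j c \<le> u j c" using Cons.prems(4) j by (simp add: rows_capped_def)
    then show "z j c \<le> u j c" using i by (auto simp: z_def)
  qed
  moreover have "rtrancl_path (residual A B u z) b1 p b'"
  proof (rule rtrancl_path_mono_on[OF q])
    fix v w assume vw: "v \<in> set (b1 # p)" "w \<in> set p" and "residual A B u y v w"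
    then obtain j where j: "v \<in> B" "w \<in> B" "j \<in> A" "0 < y j v" "y j w < u j w"
      unfolding residual_def by blast
    \<comment> \<open>As the path repeats no column, the push leaves every later target alone and
      can only raise an entry at a source, namely at \<open>b1\<close>.\<close>
    have "v \<noteq> b" "w \<noteq> b" "w \<noteq> b1" using vw Cons.prems(2) by auto
    then have "z j w = y j w" "z j v \<ge> y j v" by (auto simp: z_def)
    then show "residual A B u z v w" using j unfolding residual_def by (auto intro!: bexI[of _ j])
  qed
  moreover have "distinct (b1 # p)" using Cons.prems(2) by simp
  ultimately obtain y' where y': "rows_capped A B u r y'"
    "\<forall>c\<in>B. (\<Sum>i\<in>A. y' i c) + of_bool (c = b1) = (\<Sum>i\<in>A. z i c) + of_bool (c = b')"
    using Cons.IH[of z b1] b1 by blast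
  have "(\<Sum>j\<in>A. z j c) + of_bool (c = b) = (\<Sum>j\<in>A. y j c) + of_bool (c = b1)" for c
  proof -
    have *: "(\<Sum>j\<in>A. of_bool (j = i \<and> c = d)) = (of_bool (c = d) :: nat)" for d
      using assms(1) i by (cases "c = d") (simp_all add: of_bool_def)
    have "(\<Sum>j\<in>A. z j c) + (\<Sum>j\<in>A. of_bool (j = i \<and> c = b)) =
        (\<Sum>j\<in>A. y j c) + (\<Sum>j\<in>A. of_bool (j = i \<and> c = b1))"
      unfolding sum.distrib[symmetric] by (simp only: z)
    then show ?thesis unfolding * .
  qed
  note zy = this
  have "(\<Sum>i\<in>A. y' i c) + of_bool (c = b) = (\<Sum>i\<in>A. y i c) + of_bool (c = b')"
    if "c \<in> B" for c
    using zy[of c] y'(2)[rule_format, OF that] by linarith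
  with y'(1) show ?case by blast
qed

text \<open>Greedy filling: each element takes as much of the remaining amount as its bound
  allows.\<close>

lemma ex_le_sum_eq:
  fixes u :: "'b \<Rightarrow> nat"
  assumes "finite B" "s \<le> sum u B"
  shows "\<exists>y. (\<forall>b. y b \<le> u b) \<and> sum y B = s"
  using assms
proof (induction B arbitrary: s)
  case empty
  then show ?case by (intro exI[of _ "\<lambda>_. 0"]) auto
next
  case (insert x B)
  have "s - min s (u x) \<le> sum u B" using insert by auto
  then obtain y where y: "\<forall>b. y b \<le> u b" "sum y B = s - min s (u x)" using insert.IH by blast
  have "sum (y(x := min s (u x))) B = sum y B" by (rule sum.cong) (use insert in auto)
  then have "sum (y(x := min s (u x))) (insert x B) = s" using insert y by simp
  then show ?case using y by (intro exI[of _ "y(x := min s (u x))"]) auto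
qed

text \<open>If no column with a deficit is reachable from a column with an excess, then the set of
  reachable columns carries at most as much of each row of \<open>y\<close> as of \<open>x\<close>, which is impossible.\<close>

lemma deficit_reachable:
  fixes x :: "'a \<Rightarrow> 'b \<Rightarrow> real"
  assumes fin: "finite A" "finite B"
    and x: "\<And>i b. i \<in> A \<Longrightarrow> b \<in> B \<Longrightarrow> 0 \<le> x i b \<and> x i b \<le> real (u i b)"
    and row: "\<And>i. i \<in> A \<Longrightarrow> (\<Sum>b\<in>B. x i b) = real (r i)"
    and col: "\<And>b. b \<in> B \<Longrightarrow> (\<Sum>i\<in>A. x i b) = real (s b)"
    and y: "rows_capped A B u r y"
    and b: "b \<in> B" "s b < (\<Sum>i\<in>A. y i b)"
  shows "\<exists>b'\<in>B. (\<Sum>i\<in>A. y i b') < s b' \<and> (residual A B u y)\<^sup>*\<^sup>* b b'"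
proof (rule ccontr)
  assume no: "\<not> ?thesis"
  define W where "W = {c \<in> B. (residual A B u y)\<^sup>*\<^sup>* b c}"
  have W: "finite W" "W \<subseteq> B" "b \<in> W" using fin b by (auto simp: W_def)
  have le: "(\<Sum>c\<in>W. real (y i c)) \<le> (\<Sum>c\<in>W. x i c)" if i: "i \<in> A" for i
  proof (cases "\<exists>c\<in>W. 0 < y i c")
    case True
    then obtain c where c: "c \<in> W" "0 < y i c" by blast
    \<comment> \<open>Row \<open>i\<close> has a unit to move out of \<open>c\<close>, so every
      unreachable column \<open>d\<close> must be saturated in that row,
      \<open>y i d = u i d\<close>; otherwise an arc from \<open>c\<close> would make it reachable.
      Since the row totals of \<open>x\<close> and \<open>y\<close> agree, the inequality reverses
      on \<open>W\<close>.\<close>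
    have "x i d \<le> real (y i d)" if d: "d \<in> B - W" for d
    proof (rule ccontr)
      assume "\<not> x i d \<le> real (y i d)"
      with x[OF i, of d] d have "real (y i d) < real (u i d)" by simp
      then have "residual A B u y c d" using c d i W by (auto simp: residual_def)
      then have "d \<in> W" using c d by (auto simp: W_def intro: rtranclp.rtrancl_into_rtrancl)
      then show False using d by simp
    qed
    then have "(\<Sum>d\<in>B - W. x i d) \<le> (\<Sum>d\<in>B - W. real (y i d))" by (rule sum_mono)
    moreover have "(\<Sum>d\<in>B. real (y i d)) = (\<Sum>d\<in>B. x i d)"
      using y i row by (simp add: rows_capped_def flip: of_nat_sum)
    moreover have "(\<Sum>d\<in>B. f d) = (\<Sum>d\<in>B - W. f d) + (\<Sum>d\<in>W. f d)" for f :: "'b \<Rightarrow> real"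
      using W fin by (simp add: sum.subset_diff)
    ultimately show ?thesis by smt
  next
    case False
    then have "(\<Sum>c\<in>W. real (y i c)) = 0" by simp
    also have "\<dots> \<le> (\<Sum>c\<in>W. x i c)" using x i W by (intro sum_nonneg) blast
    finally show ?thesis .
  qed
  \<comment> \<open>No column of \<open>W\<close> has a deficit and \<open>b\<close> has an excess,
    so \<open>y\<close> carries strictly more on \<open>W\<close> than \<open>x\<close>, against the
    rowwise bound.\<close>
  have "(\<Sum>c\<in>W. \<Sum>i\<in>A. real (y i c)) = (\<Sum>i\<in>A. \<Sum>c\<in>W. real (y i c))" by (rule sum.swap)
  also have "\<dots> \<le> (\<Sum>i\<in>A. \<Sum>c\<in>W. x i c)" using le by (rule sum_mono)
  also have "\<dots> = (\<Sum>c\<in>W. \<Sum>i\<in>A. x i c)" by (rule sum.swap)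
  also have "\<dots> = (\<Sum>c\<in>W. real (s c))" using col W by (intro sum.cong) auto
  also have "\<dots> < (\<Sum>c\<in>W. \<Sum>i\<in>A. real (y i c))"
  proof (rule sum_strict_mono_ex1[OF W(1)])
    show "\<forall>c\<in>W. real (s c) \<le> (\<Sum>i\<in>A. real (y i c))"
      using no by (auto simp: W_def not_less simp flip: of_nat_sum)
    show "\<exists>c\<in>W. real (s c) < (\<Sum>i\<in>A. real (y i c))"
      using b W by (auto intro!: bexI[of _ b] simp flip: of_nat_sum)
  qed
  finally show False by simp
qed

text \<open>Among the integer matrices with correct rows, take one of least total excess. A column
  with an excess would reach one with a deficit in the residual graph, and pushing a unit along a
  simple path would lower the total.\<close>

lemma integral_transportation:
  fixes x :: "'a \<Rightarrow> 'b \<Rightarrow> real"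
  assumes fin: "finite A" "finite B"
    and x: "\<And>i b. i \<in> A \<Longrightarrow> b \<in> B \<Longrightarrow> 0 \<le> x i b \<and> x i b \<le> real (u i b)"
    and row: "\<And>i. i \<in> A \<Longrightarrow> (\<Sum>b\<in>B. x i b) = real (r i)"
    and col: "\<And>b. b \<in> B \<Longrightarrow> (\<Sum>i\<in>A. x i b) = real (s b)"
  shows "\<exists>y. (\<forall>i\<in>A. \<forall>b\<in>B. y i b \<le> u i b) \<and> (\<forall>i\<in>A. (\<Sum>b\<in>B. y i b) = r i) \<and>
    (\<forall>b\<in>B. (\<Sum>i\<in>A. y i b) = s b)"
proof -
  \<comment> \<open>Truncated subtraction makes \<open>ex\<close> count excesses only; deficits do
    not offset them.\<close>
  define ex where "ex y = (\<Sum>b\<in>B. (\<Sum>i\<in>A. y i b) - s b)" for y :: "'a \<Rightarrow> 'b \<Rightarrow> nat"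
  \<comment> \<open>A starting matrix exists row by row, since the fractional \<open>x\<close> shows
    that the bounds leave room for \<open>r i\<close>.\<close>
  have "\<exists>y. (\<forall>b. y b \<le> u i b) \<and> (\<Sum>b\<in>B. y b) = r i" if "i \<in> A" for i
  proof (rule ex_le_sum_eq[OF fin(2)])
    have "real (r i) \<le> (\<Sum>b\<in>B. real (u i b))"
      unfolding row[OF that, symmetric] using x that by (intro sum_mono) blast
    then show "r i \<le> sum (u i) B" by (simp flip: of_nat_sum)
  qed
  then obtain y where "\<forall>i\<in>A. (\<forall>b. y i b \<le> u i b) \<and> (\<Sum>b\<in>B. y i b) = r i" by metis
  then have "rows_capped A B u r y" by (simp add: rows_capped_def)
  then obtain y where y: "rows_capped A B u r y"
    and least: "\<And>y'. rows_capped A B u r y' \<Longrightarrow> ex y \<le> ex y'"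
    using ex_has_least_nat[of "rows_capped A B u r" y ex] by blast
  have no_excess: "(\<Sum>i\<in>A. y i b) \<le> s b" if b: "b \<in> B" for b
  proof (rule ccontr)
    assume "\<not> ?thesis"
    then have gt: "s b < (\<Sum>i\<in>A. y i b)" by simp
    obtain b' where b': "b' \<in> B" "(\<Sum>i\<in>A. y i b') < s b'" "(residual A B u y)\<^sup>*\<^sup>* b b'"
      using deficit_reachable[OF fin x row col y b gt] by blast
    then obtain p where "rtrancl_path (residual A B u y) b p b'" "distinct (b # p)"
      by (meson rtranclp_eq_rtrancl_path rtrancl_path_distinct)
    then obtain y' where y': "rows_capped A B u r y'"
      "\<forall>c\<in>B. (\<Sum>i\<in>A. y' i c) + of_bool (c = b) = (\<Sum>i\<in>A. y i c) + of_bool (c = b')"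
      using augment_along_path[OF fin _ _ b y] by blast
    have "ex y' < ex y" unfolding ex_def
    proof (rule sum_strict_mono_ex1[OF fin(2)])
      \<comment> \<open>The deficit at \<open>b'\<close> absorbs the added unit, so its truncated
        excess stays \<open>0\<close>.\<close>
      show "\<forall>c\<in>B. (\<Sum>i\<in>A. y' i c) - s c \<le> (\<Sum>i\<in>A. y i c) - s c"
      proof
        fix c assume "c \<in> B"
        with y' have "(\<Sum>i\<in>A. y' i c) + of_bool (c = b) = (\<Sum>i\<in>A. y i c) + of_bool (c = b')" by blast
        then show "(\<Sum>i\<in>A. y' i c) - s c \<le> (\<Sum>i\<in>A. y i c) - s c"
          using b'(2) by (cases "c = b'"; cases "c = b") auto
      qed
      have "b \<noteq> b'" using gt b' by auto
      then have "(\<Sum>i\<in>A. y' i b) + 1 = (\<Sum>i\<in>A. y i b)" using y'(2) b by force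
      then show "\<exists>c\<in>B. (\<Sum>i\<in>A. y' i c) - s c < (\<Sum>i\<in>A. y i c) - s c"
        using gt b by (intro bexI[of _ b]) auto
    qed
    then show False using least[OF y'(1)] by simp
  qed
  \<comment> \<open>Through the row sums both sides equal the total of \<open>x\<close>; with no
    excess anywhere, equal totals leave no deficit either.\<close>
  have "real (\<Sum>b\<in>B. \<Sum>i\<in>A. y i b) = real (\<Sum>b\<in>B. s b)"
  proof -
    have "(\<Sum>b\<in>B. \<Sum>i\<in>A. y i b) = (\<Sum>i\<in>A. r i)"
      using y by (subst sum.swap) (simp add: rows_capped_def)
    moreover have "(\<Sum>i\<in>A. real (r i)) = (\<Sum>b\<in>B. real (s b))"
      using row col sum.swap[of x B A] by simp
    ultimately show ?thesis by simp
  qed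
  then have "(\<Sum>b\<in>B. \<Sum>i\<in>A. y i b) = (\<Sum>b\<in>B. s b)" by linarith
  then have "(\<Sum>i\<in>A. y i b) = s b" if "b \<in> B" for b
    using sum_mono_inv[OF _ _ that fin(2), of "\<lambda>b. \<Sum>i\<in>A. y i b" s] no_excess by blast
  then show ?thesis using y unfolding rows_capped_def by blast
qed

section \<open>Detaching vertices\<close>

lemma sum_Pow_insert:
  assumes "finite V" "v \<notin> V"
  shows "sum f (Pow (insert v V)) = (\<Sum>S\<in>Pow V. f S + f (insert v S))"
proof -
  have "inj_on (insert v) (Pow V)" using assms(2) by (intro inj_onI) (metis Pow_iff in_mono insert_ident)
  moreover have "Pow V \<inter> insert v ` Pow V = {}" using assms(2) by auto
  ultimately show ?thesis
    using assms(1) by (simp add: Pow_insert sum.union_disjoint sum.reindex sum.distrib)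
qed

text \<open>Here \<open>c i j S\<close> counts the edges of colour \<open>i\<close> and final size \<open>h j\<close> whose trace on the set
  \<open>V\<close> of vertices detached so far is \<open>S\<close>; their remaining hinges sit at a single amalgamated vertex
  that represents the other \<open>n - card V\<close> vertices.\<close>

definition detachment ::
    "nat \<Rightarrow> nat \<Rightarrow> nat \<Rightarrow> (nat \<Rightarrow> nat) \<Rightarrow> (nat \<Rightarrow> nat) \<Rightarrow> (nat \<Rightarrow> nat) \<Rightarrow> (nat \<Rightarrow> nat \<Rightarrow> nat) \<Rightarrow>
      'v set \<Rightarrow> (nat \<Rightarrow> nat \<Rightarrow> 'v set \<Rightarrow> nat) \<Rightarrow> bool" where
  "detachment n k m r l h a V c \<longleftrightarrow>
     (\<forall>j<m. \<forall>S\<in>Pow V. (\<Sum>i<k. c i j S) =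
        (if card S \<le> h j then l j * ((n - card V) choose (h j - card S)) else 0)) \<and>
     (\<forall>i<k. \<forall>j<m. (\<Sum>S\<in>Pow V. c i j S) = a i j) \<and>
     (\<forall>i<k. \<forall>v\<in>V. (\<Sum>j<m. \<Sum>S\<in>Pow V. if v \<in> S then c i j S else 0) = r i)"

text \<open>The new vertex \<open>v\<close> receives a \<open>1 / N\<close> share of the amalgamated
  hinges in every class. This fractional solution has integral row and column sums, so
  transportation rounds it.\<close>

lemma detachment_step:
  assumes V: "finite V" "v \<notin> V" "card V < n"
    and a: "\<And>i. i < k \<Longrightarrow> (\<Sum>j<m. a i j * h j) = n * r i"
    and c: "detachment n k m r l h a V c"
  shows "\<exists>c'. detachment n k m r l h a (insert v V) c'"
proof -
  define N where "N = n - card V"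
  have N: "0 < N" and N': "n - card (insert v V) = N - 1" using V by (auto simp: N_def)
  have c1: "(\<Sum>i<k. c i j S) = (if card S \<le> h j then l j * (N choose (h j - card S)) else 0)"
    if "j < m" "S \<in> Pow V" for j S
    using c that by (simp add: detachment_def N_def)
  have c2: "(\<Sum>S\<in>Pow V. c i j S) = a i j" if "i < k" "j < m" for i j
    using c that by (simp add: detachment_def)
  have c3: "(\<Sum>j<m. \<Sum>S\<in>Pow V. if w \<in> S then c i j S else 0) = r i" if "i < k" "w \<in> V" for i w
    using c that by (simp add: detachment_def)
  \<comment> \<open>The number of edges with trace \<open>S\<close> that must be joined to
    \<open>v\<close>: the part of \<open>N choose (h j - card S)\<close> counting sets through
    \<open>v\<close>. It is \<open>0\<close> once no hinge is left to detach.\<close>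
  define t where
    "t j S = (if card S < h j then l j * ((N - 1) choose (h j - card S - 1)) else 0)"
    for j and S :: "'a set"
  \<comment> \<open>On nonempty classes the subtraction \<open>h j - card S\<close> is thus exact,
    and the share \<open>(h j - card S) / N\<close> is at most 1.\<close>
  have c_zero: "card S \<le> h j \<and> h j - card S \<le> N" if "c i j S \<noteq> 0" "i < k" "j < m" "S \<in> Pow V" for i j S
  proof -
    have "(\<Sum>i<k. c i j S) \<noteq> 0" using that by auto
    then show ?thesis unfolding c1[OF that(3,4)] by (auto split: if_splits simp: not_less binomial_eq_0_iff)
  qed
  \<comment> \<open>Colour \<open>i\<close> has \<open>n * r i\<close> hinges in all, of which
    \<open>card V * r i\<close> sit at detached vertices; the rest are at the amalgamated
    vertex.\<close>
  have total: "(\<Sum>j<m. \<Sum>S\<in>Pow V. c i j S * (h j - card S)) = N * r i" if i: "i < k" for i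
  proof -
    have "(\<Sum>j<m. \<Sum>S\<in>Pow V. c i j S * (h j - card S)) + (\<Sum>j<m. \<Sum>S\<in>Pow V. c i j S * card S) =
        (\<Sum>j<m. \<Sum>S\<in>Pow V. c i j S * h j)"
      unfolding sum.distrib[symmetric]
    proof (intro sum.cong refl)
      fix j S assume "j \<in> {..<m}" "S \<in> Pow V"
      with c_zero[OF _ i, of j S] show "c i j S * (h j - card S) + c i j S * card S = c i j S * h j"
        by (cases "c i j S = 0") (auto simp flip: distrib_left)
    qed
    also have "\<dots> = (\<Sum>j<m. a i j * h j)"
      by (intro sum.cong refl) (simp add: c2[OF i] flip: sum_distrib_right)
    also have "\<dots> = n * r i" using a i by simp
    also have "(\<Sum>j<m. \<Sum>S\<in>Pow V. c i j S * card S) =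
        (\<Sum>j<m. \<Sum>S\<in>Pow V. \<Sum>w\<in>V. if w \<in> S then c i j S else 0)"
    proof (intro sum.cong refl)
      fix j S assume "S \<in> Pow V"
      then have "V \<inter> S = S" by auto
      then show "c i j S * card S = (\<Sum>w\<in>V. if w \<in> S then c i j S else 0)"
        using V by (simp add: sum.If_cases)
    qed
    also have "\<dots> = (\<Sum>j<m. \<Sum>w\<in>V. \<Sum>S\<in>Pow V. if w \<in> S then c i j S else 0)"
      by (intro sum.cong refl sum.swap)
    also have "\<dots> = (\<Sum>w\<in>V. \<Sum>j<m. \<Sum>S\<in>Pow V. if w \<in> S then c i j S else 0)"
      by (rule sum.swap)
    also have "\<dots> = card V * r i" using c3[OF i] by simp
    finally show ?thesis by (simp add: N_def diff_mult_distrib)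
  qed
  \<comment> \<open>Each edge of the class has \<open>h j - card S\<close> amalgamated hinges,
    shared equally among \<open>N\<close> vertices.\<close>
  define x where "x i b = real (c i (fst b) (snd b) * (h (fst b) - card (snd b))) / real N"
    for i and b :: "nat \<times> 'a set"
  have "\<exists>d. (\<forall>i\<in>{..<k}. \<forall>b\<in>{..<m} \<times> Pow V. d i b \<le> c i (fst b) (snd b)) \<and>
      (\<forall>i\<in>{..<k}. (\<Sum>b\<in>{..<m} \<times> Pow V. d i b) = r i) \<and>
      (\<forall>b\<in>{..<m} \<times> Pow V. (\<Sum>i\<in>{..<k}. d i b) = t (fst b) (snd b))"
  proof (rule integral_transportation[where x = x])
    show "finite ({..<m} \<times> Pow V)" using V by simp
    show "0 \<le> x i b \<and> x i b \<le> real (c i (fst b) (snd b))"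
      if "i \<in> {..<k}" "b \<in> {..<m} \<times> Pow V" for i b
    proof -
      have "c i (fst b) (snd b) * (h (fst b) - card (snd b)) \<le> c i (fst b) (snd b) * N"
        using that c_zero[of i "fst b" "snd b"] by (cases "c i (fst b) (snd b) = 0") auto
      then have "real (c i (fst b) (snd b) * (h (fst b) - card (snd b))) \<le> real (c i (fst b) (snd b)) * real N"
        unfolding of_nat_mult[symmetric] of_nat_le_iff .
      then show ?thesis using N by (simp add: x_def divide_le_eq)
    qed
    show "(\<Sum>b\<in>{..<m} \<times> Pow V. x i b) = real (r i)" if "i \<in> {..<k}" for i
    proof -
      have "(\<Sum>b\<in>{..<m} \<times> Pow V. x i b) =
          real (\<Sum>j<m. \<Sum>S\<in>Pow V. c i j S * (h j - card S)) / real N"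
        unfolding x_def sum_divide_distrib[symmetric] of_nat_sum[symmetric]
        by (simp only: sum.cartesian_product split_def)
      also have "\<dots> = real (N * r i) / real N" using total[of i] that by simp
      finally show ?thesis using N by simp
    qed
    show "(\<Sum>i\<in>{..<k}. x i b) = real (t (fst b) (snd b))" if "b \<in> {..<m} \<times> Pow V" for b
    proof -
      obtain j S where b: "b = (j, S)" "j < m" "S \<in> Pow V" using \<open>b \<in> _\<close> by (cases b) auto
      \<comment> \<open>The absorption identity for binomial coefficients makes the column sums
        integral.\<close>
      have "(\<Sum>i<k. c i j S) * (h j - card S) = N * t j S"
      proof (cases "card S < h j")
        case True
        then show ?thesis
          using times_binomial_minus1_eq[of "h j - card S" N] c1[OF b(2,3)]
          by (simp add: t_def mult.commute mult.left_commute)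
      qed (simp add: t_def)
      then have "real ((\<Sum>i<k. c i j S) * (h j - card S)) = real (N * t j S)" by simp
      moreover have "(\<Sum>i<k. x i b) = real ((\<Sum>i<k. c i j S) * (h j - card S)) / real N"
        by (simp add: x_def b sum_distrib_right flip: sum_divide_distrib)
      ultimately show ?thesis using N by (simp add: b)
    qed
  qed simp
  then obtain d where d: "\<And>i j S. i < k \<Longrightarrow> j < m \<Longrightarrow> S \<in> Pow V \<Longrightarrow> d i (j, S) \<le> c i j S"
    "\<And>i. i < k \<Longrightarrow> (\<Sum>b\<in>{..<m} \<times> Pow V. d i b) = r i"
    "\<And>j S. j < m \<Longrightarrow> S \<in> Pow V \<Longrightarrow> (\<Sum>i<k. d i (j, S)) = t j S"
  proof (elim exE, goal_cases)
    case (1 d)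
    show ?case by (rule 1(1)[of d]) (use 1(2) in auto)
  qed
  \<comment> \<open>The \<open>d i (j, S)\<close> edges that receive \<open>v\<close> move to the
    trace \<open>insert v S\<close>; the others keep \<open>S\<close>. The bound
    \<open>d \<le> c\<close> makes the subtraction exact.\<close>
  define c' where "c' i j T = (if v \<in> T then d i (j, T - {v}) else c i j T - d i (j, T))" for i j T
  have c'_old: "c' i j S = c i j S - d i (j, S)" and c'_new: "c' i j (insert v S) = d i (j, S)"
    if "S \<in> Pow V" for i j S
  proof -
    have "v \<notin> S" using that V by auto
    then show "c' i j S = c i j S - d i (j, S)" "c' i j (insert v S) = d i (j, S)"
      by (auto simp: c'_def)
  qed
  have c'_sum: "c' i j S + c' i j (insert v S) = c i j S" if "i < k" "j < m" "S \<in> Pow V" for i j S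
    using d(1)[OF that] that(3) by (simp add: c'_old c'_new)
  have card_insert: "card (insert v S) = Suc (card S)" if "S \<in> Pow V" for S
    using that V by (subst card_insert_disjoint) (auto intro: finite_subset)
  have "detachment n k m r l h a (insert v V) c'" unfolding detachment_def N'
  proof (intro conjI allI impI ballI)
    fix j T assume j: "j < m" and T: "T \<in> Pow (insert v V)"
    show "(\<Sum>i<k. c' i j T) = (if card T \<le> h j then l j * ((N - 1) choose (h j - card T)) else 0)"
    proof (cases "v \<in> T")
      case True
      then obtain S where S: "T = insert v S" "S \<in> Pow V" using T by (metis Pow_iff insert_Diff subset_insert_iff)
      have "(\<Sum>i<k. c' i j T) = t j S" using d(3)[OF j S(2)] S by (simp add: c'_new)
      then show ?thesis using S by (simp add: t_def card_insert Suc_le_eq)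
    next
      case False
      then have S: "T \<in> Pow V" using T by auto
      have "(\<Sum>i<k. c' i j T) + (\<Sum>i<k. c' i j (insert v T)) = (\<Sum>i<k. c i j T)"
        unfolding sum.distrib[symmetric] using c'_sum j S by (intro sum.cong) auto
      then have "(\<Sum>i<k. c' i j T) + t j T = (\<Sum>i<k. c i j T)"
        using d(3)[OF j S] S by (simp add: c'_new)
      \<comment> \<open>Pascal's rule: the sets through \<open>v\<close> are accounted for by
        \<open>t j T\<close>.\<close>
      moreover have "(\<Sum>i<k. c i j T) =
          (if card T \<le> h j then l j * ((N - 1) choose (h j - card T)) else 0) + t j T"
      proof (cases "card T < h j")
        case True
        then obtain p where p: "h j - card T = Suc p" by (metis Suc_diff_Suc)
        obtain M where M: "N = Suc M" using N by (metis Suc_pred')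
        show ?thesis unfolding c1[OF j S] t_def using True by (simp add: p M algebra_simps)
      qed (simp add: c1[OF j S] t_def)
      ultimately show ?thesis by linarith
    qed
  next
    fix i j assume "i < k" "j < m"
    then show "(\<Sum>S\<in>Pow (insert v V). c' i j S) = a i j"
      unfolding sum_Pow_insert[OF V(1,2)] using c2 by (simp add: c'_sum)
  next
    fix i w assume i: "i < k" and w: "w \<in> insert v V"
    show "(\<Sum>j<m. \<Sum>S\<in>Pow (insert v V). if w \<in> S then c' i j S else 0) = r i"
    proof (cases "w = v")
      case True
      have "(\<Sum>S\<in>Pow (insert v V). if w \<in> S then c' i j S else 0) = (\<Sum>S\<in>Pow V. d i (j, S))" for j
        unfolding sum_Pow_insert[OF V(1,2)] True
        using V by (intro sum.cong) (auto simp: c'_new)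
      then show ?thesis using d(2)[OF i] by (simp add: sum.cartesian_product split_def)
    next
      case False
      \<comment> \<open>Adding \<open>v\<close> to a trace does not affect whether it contains
        \<open>w\<close>, so the two halves of a split class add up to the old count.\<close>
      have "(\<Sum>S\<in>Pow (insert v V). if w \<in> S then c' i j S else 0) =
          (\<Sum>S\<in>Pow V. if w \<in> S then c i j S else 0)" if "j < m" for j
        unfolding sum_Pow_insert[OF V(1,2)]
        using False i that by (intro sum.cong) (auto simp: c'_sum)
      then show ?thesis using c3[OF i, of w] w False by simp
    qed
  qed
  then show ?thesis by (rule exI[of _ c'])
qed

lemma detachment_exists:
  assumes "finite U" "card U = n"
    and a: "\<And>i. i < k \<Longrightarrow> (\<Sum>j<m. a i j * h j) = n * r i"
    and s: "\<And>j. j < m \<Longrightarrow> (\<Sum>i<k. a i j) = l j * (n choose h j)"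
  shows "\<exists>c. detachment n k m r l h a U c"
proof -
  have "V \<subseteq> U \<Longrightarrow> \<exists>c. detachment n k m r l h a V c" if "finite V" for V
    using that
  proof (induction V rule: finite_induct)
    case empty
    \<comment> \<open>Before any detachment the only trace is the empty set, and it carries all
      \<open>a i j\<close> edges.\<close>
    show ?case by (rule exI[of _ "\<lambda>i j S. a i j"]) (simp add: detachment_def s)
  next
    case (insert v V)
    then obtain c where c: "detachment n k m r l h a V c" by blast
    have "V \<subset> U" using insert by auto
    then have "card V < n" using assms psubset_card_mono by blast
    then show ?case using detachment_step[OF insert(1,2) _ a c] by blast
  qed
  then show ?thesis using assms(1) by blast
qed

text \<open>The binomial coefficient \<open>0 choose (h j - card S)\<close> vanishes unless \<open>S\<close> has its final size.\<close>

lemma edge_counts_exist: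
  assumes "finite U" "card U = n"
    and "\<And>i. i < k \<Longrightarrow> (\<Sum>j<m. a i j * h j) = n * r i"
    and "\<And>j. j < m \<Longrightarrow> (\<Sum>i<k. a i j) = l j * (n choose h j)"
  obtains c :: "nat \<Rightarrow> nat \<Rightarrow> 'v set \<Rightarrow> nat"
  where "\<And>j S. j < m \<Longrightarrow> S \<subseteq> U \<Longrightarrow> card S = h j \<Longrightarrow> (\<Sum>i<k. c i j S) = l j"
    and "\<And>i j S. i < k \<Longrightarrow> j < m \<Longrightarrow> S \<subseteq> U \<Longrightarrow> card S \<noteq> h j \<Longrightarrow> c i j S = 0"
    and "\<And>i v. i < k \<Longrightarrow> v \<in> U \<Longrightarrow> (\<Sum>j<m. \<Sum>S\<in>Pow U. if v \<in> S then c i j S else 0) = r i"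
proof -
  obtain c where c: "detachment n k m r l h a U c" using detachment_exists[OF assms] by blast
  have sum: "(\<Sum>i<k. c i j S) = (if card S = h j then l j else 0)" if "j < m" "S \<subseteq> U" for j S
    using c that assms(2) by (auto simp: detachment_def)
  show ?thesis
  proof
    show "c i j S = 0" if "i < k" "j < m" "S \<subseteq> U" "card S \<noteq> h j" for i j S
      using sum[OF that(2,3)] that by simp
  qed (use c sum in \<open>auto simp: detachment_def\<close>)
qed

section \<open>Factorizations and edge counts\<close>

text \<open>Used to distribute the parallel edges on one vertex set among the colours; the last
  colour takes what the earlier ones leave over.\<close>

lemma partition_into_sizes:
  fixes f :: "nat \<Rightarrow> nat"
  assumes "finite X" "card X = (\<Sum>i<k. f i)"
  shows "\<exists>g. g ` X \<subseteq> {..<k} \<and> (\<forall>i<k. card {e \<in> X. g e = i} = f i)"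
  using assms
proof (induction k arbitrary: X)
  case 0
  then show ?case by auto
next
  case (Suc k)
  have "(\<Sum>i<k. f i) \<le> card X" using Suc.prems(2) by simp
  then obtain Y where Y: "Y \<subseteq> X" "card Y = (\<Sum>i<k. f i)" using obtain_subset_with_card_n by metis
  have "finite Y" using Y Suc.prems(1) finite_subset by blast
  then obtain g where g: "g ` Y \<subseteq> {..<k}" "\<forall>i<k. card {e \<in> Y. g e = i} = f i"
    using Suc.IH Y(2) by blast
  define g' where "g' e = (if e \<in> Y then g e else k)" for e
  have "g' ` X \<subseteq> {..<Suc k}" using g(1) by (auto simp: g'_def less_Suc_eq)
  moreover have "card {e \<in> X. g' e = i} = f i" if "i < Suc k" for i
  proof (cases "i = k")
    case True
    have "{e \<in> X. g' e = i} = X - Y" using g(1) True by (auto simp: g'_def)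
    then show ?thesis
      using Y Suc.prems \<open>finite Y\<close> True by (simp add: card_Diff_subset)
  next
    case False
    have "{e \<in> X. g' e = i} = {e \<in> Y. g e = i}" using False Y(1) by (auto simp: g'_def)
    then show ?thesis using g(2) that False by simp
  qed
  ultimately show ?case by blast
qed

section \<open>Edges of a complete hypergraph as vertex sets\<close>

definition support :: "('v, 'e) hypergraph \<Rightarrow> 'e \<Rightarrow> 'v set" where
  "support G e = set_mset (ends G e)"

text \<open>Every hinge of such an edge is simple, so \<open>ends G e\<close> carries the same
  information as its underlying set, and later counts can be made over sets.\<close>

lemma complete_hypergraph_support:
  assumes "is_complete_hypergraph n L H G"
  shows "e \<in> edges G \<Longrightarrow> support G e \<subseteq> verts G"
    and "e \<in> edges G \<Longrightarrow> \<exists>j<dim_vec H. card (support G e) = H $ j"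
    and "e \<in> edges G \<Longrightarrow> count (ends G e) v = of_bool (v \<in> support G e)"
    and "\<lbrakk>j < dim_vec H; S \<subseteq> verts G; card S = H $ j\<rbrakk> \<Longrightarrow>
      card {e \<in> edges G. support G e = S} = L $ j"
proof -
  have fin: "finite S" if "S \<subseteq> verts G" for S
    using assms that finite_subset by (auto simp: is_complete_hypergraph_def)
  have ex: "\<exists>j<dim_vec H. \<exists>S\<subseteq>verts G. card S = H $ j \<and> ends G e = mset_set S" if "e \<in> edges G" for e
    using assms that by (simp add: is_complete_hypergraph_def)
  have supp: "support G e \<subseteq> verts G \<and> (\<exists>j<dim_vec H. card (support G e) = H $ j) \<and>
      ends G e = mset_set (support G e)" if e: "e \<in> edges G" for e
  proof -
    obtain j S where S: "j < dim_vec H" "S \<subseteq> verts G" "card S = H $ j" "ends G e = mset_set S"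
      using ex[OF e] by blast
    then have "support G e = S" using fin by (simp add: support_def)
    then show ?thesis using S by auto
  qed
  show "e \<in> edges G \<Longrightarrow> support G e \<subseteq> verts G"
    "e \<in> edges G \<Longrightarrow> \<exists>j<dim_vec H. card (support G e) = H $ j"
    using supp by blast+
  show "count (ends G e) v = of_bool (v \<in> support G e)" if "e \<in> edges G"
    using supp[OF that] fin by (metis count_mset_set(1,3) of_bool_eq)
  assume S: "j < dim_vec H" "S \<subseteq> verts G" "card S = H $ j"
  have "support G e = S \<longleftrightarrow> ends G e = mset_set S" if "e \<in> edges G" for e
    using supp[OF that] fin[OF S(2)] by (auto simp: support_def)
  then have "{e \<in> edges G. support G e = S} = {e \<in> edges G. ends G e = mset_set S}" by auto
  then show "card {e \<in> edges G. support G e = S} = L $ j"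
    using assms S by (simp add: is_complete_hypergraph_def)
qed

text \<open>Grouping edges by support brings degrees into the form of the sums prescribed for the
  counts \<open>c i j S\<close>.\<close>

lemma hdegree_by_support:
  assumes "is_complete_hypergraph n L H G" "F \<subseteq> edges G"
  shows "hdegree (G\<lparr>edges := F\<rparr>) v =
    (\<Sum>S\<in>Pow (verts G). if v \<in> S then card {e \<in> F. support G e = S} else 0)"
proof -
  have fin: "finite F" "finite (Pow (verts G))"
    using assms finite_subset by (auto simp: is_complete_hypergraph_def)
  have "hdegree (G\<lparr>edges := F\<rparr>) v = (\<Sum>e\<in>F. of_bool (v \<in> support G e))"
    using complete_hypergraph_support(3)[OF assms(1)] assms(2)
    by (auto simp: hdegree_def intro!: sum.cong)
  also have "\<dots> = (\<Sum>S\<in>Pow (verts G). \<Sum>e\<in>{e \<in> F. support G e = S}. of_bool (v \<in> support G e))"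
    using complete_hypergraph_support(1)[OF assms(1)] assms(2)
    by (intro sum.group[symmetric] fin) auto
  also have "\<dots> = (\<Sum>S\<in>Pow (verts G). if v \<in> S then card {e \<in> F. support G e = S} else 0)"
    by (intro sum.cong refl) auto
  finally show ?thesis .
qed

text \<open>The handshake identity: the hinges of \<open>F\<close> are counted at the vertices and
  at the edges.\<close>

lemma sum_hdegree:
  assumes "is_complete_hypergraph n L H G" "F \<subseteq> edges G"
  shows "(\<Sum>v\<in>verts G. hdegree (G\<lparr>edges := F\<rparr>) v) = (\<Sum>e\<in>F. card (support G e))"
proof -
  have U: "finite (verts G)" using assms(1) by (simp add: is_complete_hypergraph_def)
  have "(\<Sum>v\<in>verts G. hdegree (G\<lparr>edges := F\<rparr>) v) = (\<Sum>v\<in>verts G. \<Sum>e\<in>F. of_bool (v \<in> support G e))"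
    using complete_hypergraph_support(3)[OF assms(1)] assms(2)
    by (auto simp: hdegree_def intro!: sum.cong)
  also have "\<dots> = (\<Sum>e\<in>F. \<Sum>v\<in>verts G. of_bool (v \<in> support G e))" by (rule sum.swap)
  also have "\<dots> = (\<Sum>e\<in>F. card (support G e))"
  proof (intro sum.cong refl)
    fix e assume "e \<in> F"
    then have "verts G \<inter> support G e = support G e"
      using complete_hypergraph_support(1)[OF assms(1)] assms(2) by blast
    then show "(\<Sum>v\<in>verts G. of_bool (v \<in> support G e)) = card (support G e)"
      using U by (simp add: of_bool_def sum.If_cases)
  qed
  finally show ?thesis .
qed

lemma card_edges_of_size:
  assumes "is_complete_hypergraph n L H G" "j < dim_vec H"
  shows "card {e \<in> edges G. card (support G e) = H $ j} = L $ j * (n choose (H $ j))"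
proof -
  have fin: "finite (edges G)" "finite (verts G)" and n: "card (verts G) = n"
    using assms(1) by (auto simp: is_complete_hypergraph_def)
  let ?B = "{S. S \<subseteq> verts G \<and> card S = H $ j}"
  have "{e \<in> edges G. card (support G e) = H $ j} = (\<Union>S\<in>?B. {e \<in> edges G. support G e = S})"
    using complete_hypergraph_support(1)[OF assms(1)] by auto
  also have "card \<dots> = (\<Sum>S\<in>?B. card {e \<in> edges G. support G e = S})"
    using fin by (intro card_UN_disjoint) auto
  also have "\<dots> = (\<Sum>S\<in>?B. L $ j)"
    using complete_hypergraph_support(4)[OF assms] by (intro sum.cong) auto
  also have "\<dots> = L $ j * (n choose (H $ j))" using fin n by (simp add: n_subsets)
  finally show ?thesis .
qed

section \<open>Passing between factorizations and edge counts\<close>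

text \<open>Edges with the same support contribute equally to every degree, so on each vertex set
  any colouring with the prescribed number of edges per colour will do.\<close>

lemma factorization_of_counts:
  fixes R L H :: "nat vec" and G :: "('v, 'e) hypergraph"
  assumes G: "is_complete_hypergraph n L H G"
    and inj: "inj_on (($) H) {..<dim_vec H}"
    and c1: "\<And>j S. j < dim_vec H \<Longrightarrow> S \<subseteq> verts G \<Longrightarrow> card S = H $ j \<Longrightarrow>
      (\<Sum>i<dim_vec R. c i j S) = L $ j"
    and c2: "\<And>i j S. i < dim_vec R \<Longrightarrow> j < dim_vec H \<Longrightarrow> S \<subseteq> verts G \<Longrightarrow> card S \<noteq> H $ j \<Longrightarrow>
      c i j S = 0"
    and c3: "\<And>i v. i < dim_vec R \<Longrightarrow> v \<in> verts G \<Longrightarrow>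
      (\<Sum>j<dim_vec H. \<Sum>S\<in>Pow (verts G). if v \<in> S then c i j S else 0) = R $ i"
  shows "factorizable R G"
proof -
  note supp = complete_hypergraph_support[OF G]
  have fin: "finite (edges G)" using G by (simp add: is_complete_hypergraph_def)
  have ex: "\<exists>g. g ` {e \<in> edges G. support G e = S} \<subseteq> {..<dim_vec R} \<and>
      (\<forall>i<dim_vec R. card {e \<in> {e \<in> edges G. support G e = S}. g e = i} = (\<Sum>j<dim_vec H. c i j S))"
    if "S \<in> Pow (verts G)" for S
  proof (rule partition_into_sizes)
    have S: "S \<subseteq> verts G" using that by simp
    show "card {e \<in> edges G. support G e = S} = (\<Sum>i<dim_vec R. \<Sum>j<dim_vec H. c i j S)"
    proof (cases "\<exists>j<dim_vec H. card S = H $ j")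
      case True
      then obtain j where j: "j < dim_vec H" "card S = H $ j" by blast
      have "(\<Sum>j'<dim_vec H. c i j' S) = c i j S" if i: "i < dim_vec R" for i
      proof -
        \<comment> \<open>Sizes are distinct, so only one index \<open>j\<close> matches
          \<open>card S\<close>.\<close>
        have "c i j' S = 0" if "j' \<in> {..<dim_vec H} - {j}" for j'
          using that j inj by (intro c2[OF i _ S]) (auto dest: inj_onD)
        then have "(\<Sum>j'<dim_vec H. c i j' S) = (\<Sum>j'\<in>{j}. c i j' S)"
          using j by (intro sum.mono_neutral_right) auto
        then show ?thesis by simp
      qed
      then show ?thesis using supp(4)[OF j(1) S j(2)] c1[OF j(1) S j(2)] by simp
    next
      case False
      then have "{e \<in> edges G. support G e = S} = {}" using supp(2) by auto
      then have "card {e \<in> edges G. support G e = S} = 0" by (simp only: card.empty)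
      moreover have "c i j S = 0" if "i < dim_vec R" "j < dim_vec H" for i j
        using c2[OF that S] False that by auto
      ultimately show ?thesis by simp
    qed
  qed (use fin in simp)
  obtain g where "\<forall>S\<in>Pow (verts G). g S ` {e \<in> edges G. support G e = S} \<subseteq> {..<dim_vec R} \<and>
      (\<forall>i<dim_vec R. card {e \<in> {e \<in> edges G. support G e = S}. g S e = i} = (\<Sum>j<dim_vec H. c i j S))"
    using bchoice[OF ballI[OF ex]] by (rule exE)
  then have g: "\<And>S. S \<subseteq> verts G \<Longrightarrow> g S ` {e \<in> edges G. support G e = S} \<subseteq> {..<dim_vec R}"
    "\<And>S i. S \<subseteq> verts G \<Longrightarrow> i < dim_vec R \<Longrightarrow>
      card {e \<in> {e \<in> edges G. support G e = S}. g S e = i} = (\<Sum>j<dim_vec H. c i j S)"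
    by blast+
  define F where "F i = {e \<in> edges G. g (support G e) e = i}" for i
  have "is_factor (R $ i) G (G\<lparr>edges := F i\<rparr>)" if i: "i < dim_vec R" for i
  proof -
    have "hdegree (G\<lparr>edges := F i\<rparr>) v = R $ i" if v: "v \<in> verts G" for v
    proof -
      have "hdegree (G\<lparr>edges := F i\<rparr>) v =
          (\<Sum>S\<in>Pow (verts G). if v \<in> S then card {e \<in> F i. support G e = S} else 0)"
        by (rule hdegree_by_support[OF G]) (auto simp: F_def)
      also have "\<dots> = (\<Sum>S\<in>Pow (verts G). \<Sum>j<dim_vec H. if v \<in> S then c i j S else 0)"
      proof (intro sum.cong refl)
        fix S assume "S \<in> Pow (verts G)"
        then have S: "S \<subseteq> verts G" by simp
        have "{e \<in> F i. support G e = S} = {e \<in> {e \<in> edges G. support G e = S}. g S e = i}"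
          by (auto simp: F_def)
        then show "(if v \<in> S then card {e \<in> F i. support G e = S} else 0) =
            (\<Sum>j<dim_vec H. if v \<in> S then c i j S else 0)"
          using g(2)[OF S i] by simp
      qed
      also have "\<dots> = R $ i" by (subst sum.swap) (rule c3[OF i v])
      finally show ?thesis .
    qed
    then show ?thesis
      by (auto simp: is_factor_def spanning_sub_hypergraph_def regular_hypergraph_def F_def)
  qed
  moreover have "(\<Union>i<dim_vec R. F i) = edges G"
    using g(1)[OF supp(1)] by (auto simp: F_def image_subset_iff)
  moreover have "disjoint_family_on F {..<dim_vec R}"
    by (auto simp: disjoint_family_on_def F_def)
  ultimately show ?thesis unfolding factorizable_def is_factorization_def by blast
qed

text \<open>The row equations count the hinges of one class by edges and by vertices; the column
  equations hold because the classes partition the edges of each size.\<close>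

lemma counts_of_factorization:
  fixes R L H :: "nat vec" and G :: "('v, 'e) hypergraph"
  assumes G: "is_complete_hypergraph n L H G"
    and inj: "inj_on (($) H) {..<dim_vec H}"
    and F: "is_factorization R G F"
    and a: "\<And>i j. a i j = card {e \<in> F i. card (support G e) = H $ j}"
  shows "i < dim_vec R \<Longrightarrow> (\<Sum>j<dim_vec H. a i j * H $ j) = n * R $ i"
    and "j < dim_vec H \<Longrightarrow> (\<Sum>i<dim_vec R. a i j) = L $ j * (n choose (H $ j))"
proof -
  note supp = complete_hypergraph_support[OF G]
  have fin: "finite (edges G)" and n: "card (verts G) = n"
    using G by (auto simp: is_complete_hypergraph_def)
  have sub: "F i \<subseteq> edges G" if "i < dim_vec R" for i
    using F that by (auto simp: is_factorization_def)
  have finF: "finite (F i)" if "i < dim_vec R" for i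
    using sub[OF that] fin finite_subset by blast
  {
    assume i: "i < dim_vec R"
    have "(\<Sum>j<dim_vec H. a i j * H $ j) =
        (\<Sum>j<dim_vec H. \<Sum>e\<in>F i. if card (support G e) = H $ j then H $ j else 0)"
      using finF[OF i] by (simp add: a sum.If_cases Int_def)
    also have "\<dots> = (\<Sum>e\<in>F i. \<Sum>j<dim_vec H. if card (support G e) = H $ j then H $ j else 0)"
      by (rule sum.swap)
    also have "\<dots> = (\<Sum>e\<in>F i. card (support G e))"
    proof (intro sum.cong refl)
      fix e assume "e \<in> F i"
      then obtain j where j: "j < dim_vec H" "card (support G e) = H $ j"
        using supp(2) sub[OF i] by blast
      have "(\<Sum>j'<dim_vec H. if card (support G e) = H $ j' then H $ j' else 0) =
          (\<Sum>j'<dim_vec H. if j = j' then H $ j' else 0)"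
        using j inj by (intro sum.cong) (auto dest: inj_onD)
      then show "(\<Sum>j<dim_vec H. if card (support G e) = H $ j then H $ j else 0) = card (support G e)"
        using j by simp
    qed
    also have "\<dots> = (\<Sum>v\<in>verts G. hdegree (G\<lparr>edges := F i\<rparr>) v)"
      by (rule sum_hdegree[OF G sub[OF i], symmetric])
    also have "\<dots> = (\<Sum>v\<in>verts G. R $ i)"
      using F i by (intro sum.cong)
        (auto simp: is_factorization_def is_factor_def regular_hypergraph_def)
    finally show "(\<Sum>j<dim_vec H. a i j * H $ j) = n * R $ i" using n by simp
  }
  {
    assume j: "j < dim_vec H"
    have "{e \<in> edges G. card (support G e) = H $ j} =
        (\<Union>i\<in>{..<dim_vec R}. {e \<in> F i. card (support G e) = H $ j})"
      using F by (auto simp: is_factorization_def)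
    also have "card \<dots> = (\<Sum>i<dim_vec R. a i j)" unfolding a
    proof (rule card_UN_disjoint)
      have "F i \<inter> F i' = {}" if "i < dim_vec R" "i' < dim_vec R" "i \<noteq> i'" for i i'
        using F that by (simp add: is_factorization_def disjoint_family_on_def)
      then show "\<forall>i\<in>{..<dim_vec R}. \<forall>i'\<in>{..<dim_vec R}. i \<noteq> i' \<longrightarrow>
          {e \<in> F i. card (support G e) = H $ j} \<inter> {e \<in> F i'. card (support G e) = H $ j} = {}"
        by blast
    qed (use finF in auto)
    finally show "(\<Sum>i<dim_vec R. a i j) = L $ j * (n choose (H $ j))"
      using card_edges_of_size[OF G j] by simp
  }
qed

text \<open>Sum the row equations over all colours. The identity
  \<open>h j * (n choose h j) = n * ((n - 1) choose (h j - 1))\<close> brings out a factor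
  \<open>n\<close> to cancel.\<close>

lemma sum_degrees_of_counts:
  fixes a :: "nat \<Rightarrow> nat \<Rightarrow> nat"
  assumes "0 < n" "\<And>j. j < m \<Longrightarrow> 0 < h j"
    and "\<And>i. i < k \<Longrightarrow> (\<Sum>j<m. a i j * h j) = n * r i"
    and "\<And>j. j < m \<Longrightarrow> (\<Sum>i<k. a i j) = l j * (n choose h j)"
  shows "(\<Sum>i<k. r i) = (\<Sum>j<m. l j * ((n - 1) choose (h j - 1)))"
proof -
  have "n * (\<Sum>i<k. r i) = (\<Sum>i<k. \<Sum>j<m. a i j * h j)" using assms(3) by (simp add: sum_distrib_left)
  also have "\<dots> = (\<Sum>j<m. (\<Sum>i<k. a i j) * h j)" by (subst sum.swap) (simp add: sum_distrib_right)
  also have "\<dots> = (\<Sum>j<m. n * (l j * ((n - 1) choose (h j - 1))))"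
  proof (intro sum.cong refl)
    fix j assume "j \<in> {..<m}"
    then have j: "j < m" by simp
    have "(\<Sum>i<k. a i j) * h j = l j * (h j * (n choose h j))" using assms(4)[OF j] by simp
    then show "(\<Sum>i<k. a i j) * h j = n * (l j * ((n - 1) choose (h j - 1)))"
      unfolding times_binomial_minus1_eq[OF assms(2)[OF j]] by simp
  qed
  finally show ?thesis using assms(1) by (simp flip: sum_distrib_left)
qed

lemma mult_mat_vec_eq_smult_iff:
  fixes A :: "nat mat"
  assumes "A \<in> carrier_mat k m" "H \<in> carrier_vec m" "R \<in> carrier_vec k"
  shows "A *\<^sub>v H = n \<cdot>\<^sub>v R \<longleftrightarrow> (\<forall>i<k. (\<Sum>j<m. A $$ (i, j) * H $ j) = n * R $ i)"
proof -
  have "(A *\<^sub>v H) $ i = (\<Sum>j<m. A $$ (i, j) * H $ j)" if "i < k" for i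
    using assms that by (simp add: scalar_prod_def atLeast0LessThan)
  then show ?thesis using assms by (auto simp: vec_eq_iff)
qed

theorem theorem6p1:
  fixes n k m :: nat and R L H :: "nat vec" and G :: "('v, 'e) hypergraph"
  assumes "1 \<le> n"
    and "R \<in> carrier_vec k"
    and "L \<in> carrier_vec m"
    and "H \<in> carrier_vec m"
    and "\<And>j. j < m \<Longrightarrow> H $ j \<in> {1..n}"
    and "inj_on (($) H) {..<m}"
    and "is_complete_hypergraph n L H G"
  shows "factorizable R G \<longleftrightarrow>
    (\<Sum>i<k. R $ i) = (\<Sum>j<m. L $ j * ((n - 1) choose (H $ j - 1))) \<and>
    (\<exists>A \<in> carrier_mat k m.
       A *\<^sub>v H = n \<cdot>\<^sub>v R \<and>
       (\<forall>j<m. (\<Sum>i<k. A $$ (i, j)) = L $ j * (n choose (H $ j))))"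
proof
  have dims: "dim_vec R = k" "dim_vec H = m" using assms by auto
  have inj: "inj_on (($) H) {..<dim_vec H}" using assms(6) dims by simp
  note iff = mult_mat_vec_eq_smult_iff[OF _ assms(4,2), of _ n]
  {
    assume "factorizable R G"
    then obtain F where F: "is_factorization R G F" by (auto simp: factorizable_def)
    define a where "a i j = card {e \<in> F i. card (support G e) = H $ j}" for i j
    have row: "(\<Sum>j<m. a i j * H $ j) = n * R $ i" if "i < k" for i
      using counts_of_factorization(1)[OF assms(7) inj F a_def] that dims by simp
    have col: "(\<Sum>i<k. a i j) = L $ j * (n choose (H $ j))" if "j < m" for j
      using counts_of_factorization(2)[OF assms(7) inj F a_def] that dims by simp
    define A where "A = mat k m (\<lambda>(i, j). a i j)"
    have "A \<in> carrier_mat k m" by (simp add: A_def)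
    moreover from this have "A *\<^sub>v H = n \<cdot>\<^sub>v R" by (subst iff) (auto simp: A_def row)
    moreover have "\<forall>j<m. (\<Sum>i<k. A $$ (i, j)) = L $ j * (n choose (H $ j))"
      by (simp add: A_def col)
    moreover have "(\<Sum>i<k. R $ i) = (\<Sum>j<m. L $ j * ((n - 1) choose (H $ j - 1)))"
      by (rule sum_degrees_of_counts[OF _ _ row col]) (use assms(1,5) in fastforce)+
    ultimately show "(\<Sum>i<k. R $ i) = (\<Sum>j<m. L $ j * ((n - 1) choose (H $ j - 1))) \<and>
      (\<exists>A \<in> carrier_mat k m. A *\<^sub>v H = n \<cdot>\<^sub>v R \<and>
        (\<forall>j<m. (\<Sum>i<k. A $$ (i, j)) = L $ j * (n choose (H $ j))))" by blast
  }
  assume "(\<Sum>i<k. R $ i) = (\<Sum>j<m. L $ j * ((n - 1) choose (H $ j - 1))) \<and>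
    (\<exists>A \<in> carrier_mat k m. A *\<^sub>v H = n \<cdot>\<^sub>v R \<and>
      (\<forall>j<m. (\<Sum>i<k. A $$ (i, j)) = L $ j * (n choose (H $ j))))"
  then obtain A where A: "A \<in> carrier_mat k m" "A *\<^sub>v H = n \<cdot>\<^sub>v R"
    "\<And>j. j < m \<Longrightarrow> (\<Sum>i<k. A $$ (i, j)) = L $ j * (n choose (H $ j))" by blast
  have row: "\<And>i. i < k \<Longrightarrow> (\<Sum>j<m. A $$ (i, j) * H $ j) = n * R $ i" using A iff by blast
  have U: "finite (verts G)" "card (verts G) = n"
    using assms(7) by (auto simp: is_complete_hypergraph_def)
  obtain c where
    "\<And>j S. j < m \<Longrightarrow> S \<subseteq> verts G \<Longrightarrow> card S = H $ j \<Longrightarrow> (\<Sum>i<k. c i j S) = L $ j"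
    "\<And>i j S. i < k \<Longrightarrow> j < m \<Longrightarrow> S \<subseteq> verts G \<Longrightarrow> card S \<noteq> H $ j \<Longrightarrow> c i j S = 0"
    "\<And>i v. i < k \<Longrightarrow> v \<in> verts G \<Longrightarrow>
      (\<Sum>j<m. \<Sum>S\<in>Pow (verts G). if v \<in> S then c i j S else 0) = R $ i"
    using edge_counts_exist[OF U row A(3)] by blast
  then show "factorizable R G"
    using factorization_of_counts[OF assms(7) inj, where R = R] unfolding dims by blast
qed

end
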